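(* Let $M$ and $\overline{M}$ be two surfaces in $\mathbb{R}^3$ that intersect transversally, let $\gamma(s)$ be an arc-length parametrization of the intersection curve $M\cap\overline{M}$, and assume that $\gamma$ is a pseudo-geodesic line in $M$. Then $\gamma$ is a pseudo-geodesic line in $\overline{M}$ if and only if $M$ and $\overline{M}$ intersect with constant angle (along $\gamma$).
   Context: Surfaces are smooth regular orientable connected surfaces in $\mathbb{R}^3$, with Gauss maps $N$ of $M$ and $\overline{N}$ of $\overline{M}$. They intersect transversally if $T_pM\neq T_p\overline{M}$ for all $p\in M\cap\overline{M}$. They intersect with constant angle along $\gamma$ if the angle $\xi(s)\in(0,\pi)$ between $N(\gamma(s))$ and $\overline{N}(\gamma(s))$ is constant. Arc-length parametrized curves are assumed to have curvature $\kappa_\gamma>0$, so that the unit tangent $T_\gamma$ and principal normal $N_\gamma$ are defined. A curve $\gamma$ in a surface $M$ with Gauss map $N$ is a pseudo-geodesic line in $M$ if the angle $\theta$ between $N_\gamma$ and $N$ is constant along $\gamma$, where $N_\gamma=\sin\theta\,(N\times T_\gamma)+\cos\theta\,N$. *)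

theory Defs
  imports "HOL-Analysis.Analysis"
begin

unbundle cross3_syntax

(* C^k and C^infinity maps on an open set S of a normed space: all iterated directional
   derivatives up to order k exist and are continuous (for finite-dimensional domains this is
   the usual notion). *)

primrec ck_on :: "nat \<Rightarrow> 'a::real_normed_vector set \<Rightarrow> ('a \<Rightarrow> 'b::real_normed_vector) \<Rightarrow> bool"
where
  "ck_on 0 S f \<longleftrightarrow> continuous_on S f"
| "ck_on (Suc k) S f \<longleftrightarrow>
     (\<forall>x\<in>S. f differentiable at x) \<and>
     (\<forall>v. ck_on k S (\<lambda>x. frechet_derivative f (at x) v))"

definition smooth_on :: "'a::real_normed_vector set \<Rightarrow> ('a \<Rightarrow> 'b::real_normed_vector) \<Rightarrow> bool"
where
  "smooth_on S f \<longleftrightarrow> (\<forall>k. ck_on k S f)"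

definition local_parametrization ::
  "(real^3) set \<Rightarrow> (real^2) set \<Rightarrow> (real^2 \<Rightarrow> real^3) \<Rightarrow> bool"
where
  "local_parametrization M U x \<longleftrightarrow>
     open U \<and> smooth_on U x \<and>
     openin (top_of_set M) (x ` U) \<and>
     (\<exists>y. homeomorphism U (x ` U) x y) \<and>
     (\<forall>q\<in>U. inj (frechet_derivative x (at q)))"

definition regular_surface :: "(real^3) set \<Rightarrow> bool"
where
  "regular_surface M \<longleftrightarrow> (\<forall>p\<in>M. \<exists>U x. local_parametrization M U x \<and> p \<in> x ` U)"

definition smooth_on_surface :: "(real^3) set \<Rightarrow> (real^3 \<Rightarrow> real^3) \<Rightarrow> bool"
where
  "smooth_on_surface M F \<longleftrightarrow> (\<forall>U x. local_parametrization M U x \<longrightarrow> smooth_on U (F \<circ> x))"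

(* The tangent vectors at p are the velocities at p of smooth curves in M through p. *)

definition tangent_space :: "(real^3) set \<Rightarrow> real^3 \<Rightarrow> (real^3) set"
where
  "tangent_space M p =
     {v. \<exists>\<epsilon>>0. \<exists>\<alpha>. smooth_on {-\<epsilon><..<\<epsilon>} \<alpha> \<and> \<alpha> ` {-\<epsilon><..<\<epsilon>} \<subseteq> M \<and> \<alpha> 0 = p \<and>
                 (\<alpha> has_vector_derivative v) (at (0::real))}"

definition gauss_map :: "(real^3) set \<Rightarrow> (real^3 \<Rightarrow> real^3) \<Rightarrow> bool"
where
  "gauss_map M N \<longleftrightarrow>
     smooth_on_surface M N \<and>
     (\<forall>p\<in>M. norm (N p) = 1 \<and> (\<forall>v\<in>tangent_space M p. N p \<bullet> v = 0))"

definition orientable_surface :: "(real^3) set \<Rightarrow> bool"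
where
  "orientable_surface M \<longleftrightarrow> (\<exists>N. gauss_map M N)"

definition surface :: "(real^3) set \<Rightarrow> bool"
where
  "surface M \<longleftrightarrow> regular_surface M \<and> orientable_surface M \<and> connected M"

definition intersect_transversally :: "(real^3) set \<Rightarrow> (real^3) set \<Rightarrow> bool"
where
  "intersect_transversally M M' \<longleftrightarrow> (\<forall>p \<in> M \<inter> M'. tangent_space M p \<noteq> tangent_space M' p)"

definition unit_tangent :: "(real \<Rightarrow> real^3) \<Rightarrow> real \<Rightarrow> real^3"
where
  "unit_tangent \<gamma> s = vector_derivative \<gamma> (at s)"

definition curvature :: "(real \<Rightarrow> real^3) \<Rightarrow> real \<Rightarrow> real"
where
  "curvature \<gamma> s = norm (vector_derivative (unit_tangent \<gamma>) (at s))"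

definition principal_normal :: "(real \<Rightarrow> real^3) \<Rightarrow> real \<Rightarrow> real^3"
where
  "principal_normal \<gamma> s = vector_derivative (unit_tangent \<gamma>) (at s) /\<^sub>R curvature \<gamma> s"

(* Closed curves are covered by periodic parametrizations: injectivity is not required. *)

definition arc_length_curve :: "real set \<Rightarrow> (real \<Rightarrow> real^3) \<Rightarrow> bool"
where
  "arc_length_curve I \<gamma> \<longleftrightarrow>
     open I \<and> is_interval I \<and> I \<noteq> {} \<and> smooth_on I \<gamma> \<and>
     (\<forall>s\<in>I. norm (unit_tangent \<gamma> s) = 1) \<and>
     (\<forall>s\<in>I. curvature \<gamma> s > 0)"

(* theta is the oriented angle from N to the principal normal in the plane orthogonal to the
   tangent, with positively oriented basis (N, N x T). *)

definition pseudo_geodesic_line ::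
  "real set \<Rightarrow> (real \<Rightarrow> real^3) \<Rightarrow> (real^3) set \<Rightarrow> (real^3 \<Rightarrow> real^3) \<Rightarrow> bool"
where
  "pseudo_geodesic_line I \<gamma> M N \<longleftrightarrow>
     arc_length_curve I \<gamma> \<and> \<gamma> ` I \<subseteq> M \<and>
     (\<exists>\<theta>. \<forall>s\<in>I. principal_normal \<gamma> s =
        sin \<theta> *\<^sub>R (N (\<gamma> s) \<times> unit_tangent \<gamma> s) + cos \<theta> *\<^sub>R N (\<gamma> s))"

definition vec_angle :: "real^3 \<Rightarrow> real^3 \<Rightarrow> real"
where
  "vec_angle u v = arccos ((u \<bullet> v) / (norm u * norm v))"

definition intersect_with_constant_angle ::
  "real set \<Rightarrow> (real \<Rightarrow> real^3) \<Rightarrow> (real^3 \<Rightarrow> real^3) \<Rightarrow> (real^3 \<Rightarrow> real^3) \<Rightarrow> bool"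
where
  "intersect_with_constant_angle I \<gamma> N N' \<longleftrightarrow>
     (\<exists>\<xi>. 0 < \<xi> \<and> \<xi> < pi \<and> (\<forall>s\<in>I. vec_angle (N (\<gamma> s)) (N' (\<gamma> s)) = \<xi>))"

end

theory Submission
  imports Defs
begin

text \<open>In the plane orthogonal to the tangent \<open>T\<close>, with oriented basis \<open>(N, N \<times> T)\<close>, let \<open>\<phi>\<close>
  be the oriented angle of \<open>N'\<close> and \<open>\<theta>\<close>, \<open>\<theta>'\<close> the angles of the principal normal relative to
  \<open>N\<close> and \<open>N'\<close>. Then \<open>\<theta> = \<theta>' + \<phi>\<close>, so for constant \<open>\<theta>\<close> the angle \<open>\<theta>'\<close> is constant if and
  only if \<open>\<phi>\<close> is. The unoriented angle \<open>\<xi>\<close> determines \<open>\<phi>\<close> only up to sign. Transversality, that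
  is \<open>N \<noteq> \<plusminus>N'\<close>, keeps \<open>\<xi>\<close> inside \<open>(0, \<pi>)\<close>, and then continuity fixes the sign.\<close>

section \<open>Smoothness on open sets and along straight lines\<close>

lemma ck_on_cong:
  assumes "open S" and "\<And>x. x \<in> S \<Longrightarrow> f x = g x" and "ck_on k S f"
  shows "ck_on k S g"
  using assms(2,3)
proof (induction k arbitrary: f g)
  case 0
  then show ?case by (auto cong: continuous_on_cong)
next
  case (Suc k)
  have diff: "f differentiable at x" if "x \<in> S" for x
    using Suc.prems that by auto
  \<comment> \<open>Since S is open, f and g agree near each of its points. Their directional
    derivatives therefore agree on S as well, and the induction hypothesis applies to these.\<close>
  have deriv: "frechet_derivative f (at x) = frechet_derivative g (at x)" if "x \<in> S" for x
    using frechet_derivative_transform_within_open[OF diff[OF that] \<open>open S\<close> that] Suc.prems(1)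
    by blast
  have "g differentiable at x" if "x \<in> S" for x
    using has_derivative_transform_within_open[of f _ x UNIV S g] diff[OF that]
      \<open>open S\<close> that Suc.prems(1)
    unfolding differentiable_def by blast
  moreover have "ck_on k S (\<lambda>x. frechet_derivative g (at x) v)" for v
    by (rule Suc.IH[of "\<lambda>x. frechet_derivative f (at x) v"]) (use Suc.prems deriv in auto)
  ultimately show ?case by simp
qed

lemma ck_on_subset:
  assumes "ck_on k S f" and "T \<subseteq> S"
  shows "ck_on k T f"
  using assms(1)
proof (induction k arbitrary: f)
  case 0
  then show ?case using assms(2) continuous_on_subset by auto
next
  case (Suc k)
  then show ?case using assms(2) by auto
qed

lemma open_line_parameters:
  fixes p w :: "'a::real_normed_vector"
  assumes "open S"
  shows "open {t::real. p + t *\<^sub>R w \<in> S}"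
proof -
  have "continuous_on UNIV (\<lambda>t::real. p + t *\<^sub>R w)" by (intro continuous_intros)
  from open_vimage[OF assms this] show ?thesis by (simp add: vimage_def)
qed

text \<open>The factor \<open>c\<close> absorbs the increment of the parameter, so that the class of functions
  is closed under differentiation and the induction goes through.\<close>

lemma ck_on_along_line:
  fixes f :: "'a::real_normed_vector \<Rightarrow> 'b::real_normed_vector"
  assumes "open S" and "ck_on k S f"
  shows "ck_on k {t::real. p + t *\<^sub>R w \<in> S} (\<lambda>t. c *\<^sub>R f (p + t *\<^sub>R w))"
  using assms(2)
proof (induction k arbitrary: f c)
  case 0
  then have "continuous_on {t::real. p + t *\<^sub>R w \<in> S} (f \<circ> (\<lambda>t. p + t *\<^sub>R w))"
    by (intro continuous_on_compose continuous_intros) (auto elim: continuous_on_subset)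
  then show ?case by (auto simp: o_def intro: continuous_intros)
next
  case (Suc k)
  let ?J = "{t::real. p + t *\<^sub>R w \<in> S}"
  let ?g = "\<lambda>t::real. c *\<^sub>R f (p + t *\<^sub>R w)"
  have open_J: "open ?J" by (rule open_line_parameters[OF \<open>open S\<close>])
  have der: "(?g has_derivative (\<lambda>h. (c * h) *\<^sub>R frechet_derivative f (at (p + t *\<^sub>R w)) w)) (at t)"
    if "t \<in> ?J" for t
  proof -
    let ?D = "frechet_derivative f (at (p + t *\<^sub>R w))"
    have D: "(f has_derivative ?D) (at (p + t *\<^sub>R w))"
      using Suc.prems that frechet_derivative_works by auto
    have "((\<lambda>t. p + t *\<^sub>R w) has_derivative (\<lambda>h. h *\<^sub>R w)) (at t)"
      by (auto intro!: derivative_eq_intros)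
    from has_derivative_compose[OF this D]
    have "((\<lambda>t. f (p + t *\<^sub>R w)) has_derivative (\<lambda>h. ?D (h *\<^sub>R w))) (at t)" .
    then have "(?g has_derivative (\<lambda>h. c *\<^sub>R ?D (h *\<^sub>R w))) (at t)"
      by (rule has_derivative_scaleR_right)
    then show ?thesis
      using linear_cmul[OF has_derivative_linear[OF D]] by simp
  qed
  have "ck_on k ?J (\<lambda>t. frechet_derivative ?g (at t) v)" for v
  proof (rule ck_on_cong[OF open_J])
    show "ck_on k ?J (\<lambda>t. (c * v) *\<^sub>R frechet_derivative f (at (p + t *\<^sub>R w)) w)"
      using Suc.prems by (intro Suc.IH) simp
    show "(c * v) *\<^sub>R frechet_derivative f (at (p + t *\<^sub>R w)) w = frechet_derivative ?g (at t) v"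
      if "t \<in> ?J" for t
      using frechet_derivative_at[OF der[OF that]] by metis
  qed
  moreover have "?g differentiable at t" if "t \<in> ?J" for t
    using der[OF that] differentiable_def by blast
  ultimately show ?case by simp
qed

lemma smooth_on_differentiable:
  assumes "smooth_on S f" and "x \<in> S"
  shows "f differentiable at x"
proof -
  have "ck_on (Suc 0) S f" using assms(1) unfolding smooth_on_def by blast
  then show ?thesis using assms(2) by simp
qed

lemma smooth_on_imp_continuous_on: "smooth_on S f \<Longrightarrow> continuous_on S f"
  unfolding smooth_on_def by (metis ck_on.simps(1))

section \<open>Tangent planes and Gauss maps\<close>

lemma frechet_derivative_in_tangent_space:
  fixes f :: "'a::real_normed_vector \<Rightarrow> real^3"
  assumes "open S" and "smooth_on S f" and "q \<in> S" and "f ` S \<subseteq> M"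
  shows "frechet_derivative f (at q) w \<in> tangent_space M (f q)"
proof -
  let ?J = "{t::real. q + t *\<^sub>R w \<in> S}"
  \<comment> \<open>The witnessing curve is the image under f of the straight segment through q in
    direction w.\<close>
  let ?\<alpha> = "\<lambda>t::real. f (q + t *\<^sub>R w)"
  have "open ?J" by (rule open_line_parameters[OF \<open>open S\<close>])
  moreover have "0 \<in> ?J" using assms(3) by simp
  ultimately obtain e where e: "e > 0" "ball 0 e \<subseteq> ?J"
    using open_contains_ball by blast
  have J: "{-e<..<e} \<subseteq> ?J" using e(2) by (simp add: ball_eq_greaterThanLessThan)
  have "ck_on k ?J ?\<alpha>" for k
    using ck_on_along_line[OF \<open>open S\<close>, of k f q w 1] assms(2) unfolding smooth_on_def by simp
  then have sm: "smooth_on {-e<..<e} ?\<alpha>"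
    unfolding smooth_on_def using ck_on_subset J by blast
  let ?D = "frechet_derivative f (at q)"
  have "(f has_derivative ?D) (at q)"
    using smooth_on_differentiable[OF assms(2,3)] frechet_derivative_works by blast
  then have D: "(f has_derivative ?D) (at (q + 0 *\<^sub>R w))" by simp
  have "((\<lambda>t. q + t *\<^sub>R w) has_derivative (\<lambda>h. h *\<^sub>R w)) (at 0)"
    by (auto intro!: derivative_eq_intros)
  from has_derivative_compose[OF this D]
  have "(?\<alpha> has_vector_derivative ?D w) (at 0)"
    unfolding has_vector_derivative_def using linear_cmul[OF has_derivative_linear[OF D]] by simp
  then show ?thesis
    unfolding tangent_space_def using e(1) sm J assms(4) by (force intro!: exI[of _ e] exI[of _ ?\<alpha>])
qed

text \<open>The velocities of curves are not known beforehand to form a subspace. They are squeezed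
  between the range of the derivative of a parametrization, a plane by injectivity, and the
  orthogonal complement of \<open>N p\<close>, also a plane.\<close>

lemma tangent_space_eq_hyperplane:
  assumes "regular_surface M" and "gauss_map M N" and "p \<in> M"
  shows "tangent_space M p = {v. N p \<bullet> v = 0}"
proof
  show "tangent_space M p \<subseteq> {v. N p \<bullet> v = 0}"
    using assms(2,3) unfolding gauss_map_def by blast
  obtain U x q where x: "local_parametrization M U x" and q: "q \<in> U" "p = x q"
    using assms(1,3) unfolding regular_surface_def by blast
  let ?D = "frechet_derivative x (at q)"
  have U: "open U" "smooth_on U x" "inj ?D" and im: "x ` U \<subseteq> M"
    using x q(1) openin_imp_subset[of _ M "x ` U"] unfolding local_parametrization_def by auto
  have "linear ?D"
    using linear_frechet_derivative smooth_on_differentiable[OF U(2) q(1)] by blast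
  have range: "range ?D \<subseteq> tangent_space M p"
    using frechet_derivative_in_tangent_space[OF U(1,2) q(1) im] q(2) by blast
  have "dim (range ?D) = 2"
    using dim_image_eq[OF \<open>linear ?D\<close>, of UNIV] U(3) by (simp add: dim_UNIV)
  moreover have "N p \<noteq> 0"
    using assms(2,3) unfolding gauss_map_def by force
  then have "dim {v. N p \<bullet> v = 0} = 2"
    by (simp add: dim_hyperplane)
  ultimately have "range ?D = {v. N p \<bullet> v = 0}"
    using range \<open>tangent_space M p \<subseteq> _\<close>
    by (intro subspace_dim_equal linear_subspace_image \<open>linear ?D\<close> subspace_hyperplane) auto
  then show "{v. N p \<bullet> v = 0} \<subseteq> tangent_space M p" using range by simp
qed

text \<open>Smoothness of N is given only through parametrizations x. On a patch, N is recovered as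
  \<open>(N \<circ> x) \<circ> y\<close> with the continuous inverse y of x.\<close>

lemma gauss_map_continuous_on:
  assumes "regular_surface M" and "gauss_map M N"
  shows "continuous_on M N"
  unfolding continuous_on_eq_continuous_within
proof
  fix p assume "p \<in> M"
  then obtain U x where x: "local_parametrization M U x" and p: "p \<in> x ` U"
    using assms(1) unfolding regular_surface_def by blast
  obtain y where y: "homeomorphism U (x ` U) x y" and op: "openin (top_of_set M) (x ` U)"
    using x unfolding local_parametrization_def by blast
  have "continuous_on U (N \<circ> x)"
    using x assms(2) smooth_on_imp_continuous_on
    unfolding gauss_map_def smooth_on_surface_def by blast
  then have "continuous_on (x ` U) ((N \<circ> x) \<circ> y)"
    using y by (intro continuous_on_compose[of _ y]) (simp_all add: homeomorphism_def)
  then have "continuous_on (x ` U) N"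
    by (rule continuous_on_eq) (use y in \<open>auto simp: homeomorphism_def\<close>)
  then have "continuous (at p within x ` U) N"
    using p continuous_on_eq_continuous_within by blast
  moreover obtain T where "open T" "x ` U = M \<inter> T"
    using op openin_open by blast
  \<comment> \<open>The patch is relatively open in M, so limits at p within the patch and within M
    are the same.\<close>
  moreover from this have "at p within M = at p within x ` U"
    by (intro at_within_nhd[of p T]) (use p in auto)
  ultimately show "continuous (at p within M) N" by simp
qed

section \<open>The unit tangent of a curve in a surface\<close>

lemma unit_tangent_eq_frechet_derivative:
  assumes "\<gamma> differentiable at s"
  shows "unit_tangent \<gamma> s = frechet_derivative \<gamma> (at s) 1"
  using assms unfolding unit_tangent_def
  by (metis frechet_derivative_eq_vector_derivative scaleR_one)

lemma unit_tangent_continuous_on: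
  assumes "smooth_on I \<gamma>"
  shows "continuous_on I (unit_tangent \<gamma>)"
proof -
  have "ck_on (Suc 0) I \<gamma>" using assms unfolding smooth_on_def by blast
  then have "continuous_on I (\<lambda>s. frechet_derivative \<gamma> (at s) 1)" by simp
  then show ?thesis
    using unit_tangent_eq_frechet_derivative[OF smooth_on_differentiable[OF assms]]
    by (simp cong: continuous_on_cong)
qed

lemma gauss_map_orthogonal_unit_tangent:
  assumes "gauss_map M N" and "open I" and "smooth_on I \<gamma>" and "\<gamma> ` I \<subseteq> M" and "s \<in> I"
  shows "N (\<gamma> s) \<bullet> unit_tangent \<gamma> s = 0"
proof -
  have "unit_tangent \<gamma> s \<in> tangent_space M (\<gamma> s)"
    using frechet_derivative_in_tangent_space[OF assms(2,3,5,4)]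
      unit_tangent_eq_frechet_derivative[OF smooth_on_differentiable[OF assms(3,5)]] by simp
  then show ?thesis using assms(1,4,5) unfolding gauss_map_def by blast
qed

section \<open>Two unit normals n and m in the plane orthogonal to a unit vector t\<close>

locale normal_frame =
  fixes n t m :: "real^3"
  assumes unit: "norm n = 1" "norm t = 1" "norm m = 1"
    and orth: "n \<bullet> t = 0" "m \<bullet> t = 0"
begin

lemma unit_inner: "n \<bullet> n = 1" "t \<bullet> t = 1" "m \<bullet> m = 1"
  using unit by (simp_all add: dot_square_norm)

lemma inner_cross: "(n \<times> t) \<bullet> (n \<times> t) = 1" "n \<bullet> (n \<times> t) = 0" "t \<bullet> (n \<times> t) = 0"
  using unit_inner orth by (simp_all add: dot_cross inner_commute dot_cross_self)

lemma cross_nonzero: "n \<times> t \<noteq> 0"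
  using inner_cross by force

lemma expansion: "m = (n \<bullet> m) *\<^sub>R n + (m \<bullet> (n \<times> t)) *\<^sub>R (n \<times> t)"
proof -
  define d where "d = m - (n \<bullet> m) *\<^sub>R n - (m \<bullet> (n \<times> t)) *\<^sub>R (n \<times> t)"
  have "d \<bullet> n = 0" "d \<bullet> t = 0" "d \<bullet> (n \<times> t) = 0"
    using unit_inner orth inner_cross
    by (simp_all add: d_def inner_diff_left inner_diff_right inner_commute)
  \<comment> \<open>Being orthogonal to n and t, d is parallel to \<open>n \<times> t\<close> by the
    Lagrange identity; it is also orthogonal to that nonzero vector.\<close>
  then have "d = 0"
    using Lagrange[of d n t] norm_and_cross_eq_0[of d "n \<times> t"] cross_nonzero by simp
  then show ?thesis unfolding d_def by (simp add: algebra_simps)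
qed

text \<open>The map \<open>v \<mapsto> v \<times> t\<close> is a quarter turn of the plane: it sends
  n to \<open>n \<times> t\<close> and \<open>n \<times> t\<close> to \<open>- n\<close>.\<close>

lemma expansion_cross: "m \<times> t = (n \<bullet> m) *\<^sub>R (n \<times> t) - (m \<bullet> (n \<times> t)) *\<^sub>R n"
proof -
  have "(n \<times> t) \<times> t = - n"
    using Lagrange[of t n t] unit_inner orth cross_skew[of "n \<times> t" t]
    by (simp add: inner_commute)
  then have "((n \<bullet> m) *\<^sub>R n + (m \<bullet> (n \<times> t)) *\<^sub>R (n \<times> t)) \<times> t
      = (n \<bullet> m) *\<^sub>R (n \<times> t) - (m \<bullet> (n \<times> t)) *\<^sub>R n"
    by (simp add: cross_add_left cross_mult_left)
  then show ?thesis using expansion by simp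
qed

text \<open>Hence the two coordinates of m are the cosine and sine of its oriented angle from
  n.\<close>

lemma sum_squares: "(n \<bullet> m)\<^sup>2 + (m \<bullet> (n \<times> t))\<^sup>2 = 1"
proof -
  have "m \<bullet> m = (n \<bullet> m) * (n \<bullet> m) + (m \<bullet> (n \<times> t)) * (m \<bullet> (n \<times> t))"
    by (subst (2) expansion) (simp add: inner_add_right inner_commute)
  then show ?thesis using unit_inner by (simp add: power2_eq_square)
qed

lemma angle_difference:
  assumes "sin a *\<^sub>R (n \<times> t) + cos a *\<^sub>R n = sin b *\<^sub>R (m \<times> t) + cos b *\<^sub>R m"
  shows "n \<bullet> m = cos (a - b)"
proof -
  let ?r = "sin a *\<^sub>R (n \<times> t) + cos a *\<^sub>R n"
  let ?u = "n \<bullet> m" and ?v = "m \<bullet> (n \<times> t)"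
  have mt: "n \<bullet> (m \<times> t) = - ?v" "(n \<times> t) \<bullet> (m \<times> t) = ?u"
    unfolding expansion_cross using unit_inner inner_cross
    by (simp_all add: inner_diff_right inner_commute)
  have "n \<bullet> ?r = cos a" "(n \<times> t) \<bullet> ?r = sin a"
    using unit_inner inner_cross by (simp_all add: inner_add_right inner_commute)
  then have "cos a = - sin b * ?v + cos b * ?u" "sin a = sin b * ?u + cos b * ?v"
    unfolding assms using mt by (simp_all add: inner_add_right inner_commute)
  \<comment> \<open>In cos a cos b + sin a sin b the terms with \<open>?v\<close> cancel.\<close>
  then have "cos (a - b) = ?u * ((sin b)\<^sup>2 + (cos b)\<^sup>2)"
    unfolding cos_diff by algebra
  then show ?thesis by simp
qed

text \<open>Measuring from m instead of n lowers the angle by b. Both the cosine and the sine of b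
  are prescribed, because the cosine alone leaves the sign of b open.\<close>

lemma rotate_normal:
  assumes "n \<bullet> m = cos b" and "m \<bullet> (n \<times> t) = sin b"
  shows "sin a *\<^sub>R (n \<times> t) + cos a *\<^sub>R n = sin (a - b) *\<^sub>R (m \<times> t) + cos (a - b) *\<^sub>R m"
proof -
  have mt: "m \<times> t = cos b *\<^sub>R (n \<times> t) - sin b *\<^sub>R n"
    using expansion_cross assms by simp
  have m: "m = cos b *\<^sub>R n + sin b *\<^sub>R (n \<times> t)"
    using expansion assms by simp
  have "sin (a - b) *\<^sub>R (m \<times> t) + cos (a - b) *\<^sub>R m
      = (sin (a - b) * cos b + cos (a - b) * sin b) *\<^sub>R (n \<times> t)
        + (cos (a - b) * cos b - sin (a - b) * sin b) *\<^sub>R n"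
    unfolding mt by (subst m) (simp add: algebra_simps)
  also have "\<dots> = sin ((a - b) + b) *\<^sub>R (n \<times> t) + cos ((a - b) + b) *\<^sub>R n"
    by (simp only: sin_add cos_add)
  finally show ?thesis by simp
qed

end

section \<open>Transversality and the two directions of the equivalence\<close>

theorem proposition13:
  fixes M M' :: "(real^3) set"
    and N N' :: "real^3 \<Rightarrow> real^3"
    and I :: "real set"
    and \<gamma> :: "real \<Rightarrow> real^3"
  assumes "surface M" and "surface M'"
    and "gauss_map M N" and "gauss_map M' N'"
    and "intersect_transversally M M'"
    and "arc_length_curve I \<gamma>" and "\<gamma> ` I = M \<inter> M'"
    and "pseudo_geodesic_line I \<gamma> M N"
  shows "pseudo_geodesic_line I \<gamma> M' N' \<longleftrightarrow> intersect_with_constant_angle I \<gamma> N N'"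
proof -
  have I: "open I" "is_interval I" "I \<noteq> {}" "smooth_on I \<gamma>"
    and T: "\<And>s. s \<in> I \<Longrightarrow> norm (unit_tangent \<gamma> s) = 1"
    using assms(6) unfolding arc_length_curve_def by auto
  have reg: "regular_surface M" "regular_surface M'"
    using assms(1,2) unfolding surface_def by auto
  have in_M: "\<gamma> ` I \<subseteq> M" "\<gamma> ` I \<subseteq> M'" using assms(7) by auto
  have norms: "norm (N (\<gamma> s)) = 1" "norm (N' (\<gamma> s)) = 1" if "s \<in> I" for s
    using assms(3,4) in_M that unfolding gauss_map_def by auto
  have frame: "normal_frame (N (\<gamma> s)) (unit_tangent \<gamma> s) (N' (\<gamma> s))" if "s \<in> I" for s
    using norms T gauss_map_orthogonal_unit_tangent assms(3,4) I in_M that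
    by unfold_locales blast+
  obtain \<theta> where \<theta>: "\<And>s. s \<in> I \<Longrightarrow> principal_normal \<gamma> s =
      sin \<theta> *\<^sub>R (N (\<gamma> s) \<times> unit_tangent \<gamma> s) + cos \<theta> *\<^sub>R N (\<gamma> s)"
    using assms(8) unfolding pseudo_geodesic_line_def by blast
  have vec_angle: "vec_angle (N (\<gamma> s)) (N' (\<gamma> s)) = arccos (N (\<gamma> s) \<bullet> N' (\<gamma> s))"
    if "s \<in> I" for s
    using norms[OF that] by (simp add: vec_angle_def)
  have bound: "\<bar>N (\<gamma> s) \<bullet> N' (\<gamma> s)\<bar> \<le> 1" if "s \<in> I" for s
    using Cauchy_Schwarz_ineq2[of "N (\<gamma> s)" "N' (\<gamma> s)"] norms[OF that] by simp
  have transversal: "\<bar>N (\<gamma> s) \<bullet> N' (\<gamma> s)\<bar> < 1" if s: "s \<in> I" for s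
  proof (rule ccontr)
    interpret normal_frame "N (\<gamma> s)" "unit_tangent \<gamma> s" "N' (\<gamma> s)" by (rule frame[OF s])
    let ?c = "N (\<gamma> s) \<bullet> N' (\<gamma> s)"
    assume "\<not> \<bar>?c\<bar> < 1"
    then have c: "\<bar>?c\<bar> = 1" using bound[OF s] by simp
    then have "?c\<^sup>2 = 1" using abs_square_eq_1 by blast
    \<comment> \<open>By \<open>sum_squares\<close> the component of the second normal along
      \<open>n \<times> t\<close> vanishes, so the normals are parallel and the tangent planes
      coincide.\<close>
    then have "N' (\<gamma> s) = ?c *\<^sub>R N (\<gamma> s)"
      using expansion sum_squares by simp
    then have "N' (\<gamma> s) \<bullet> v = ?c * (N (\<gamma> s) \<bullet> v)" for v
      by (metis inner_scaleR_left)
    moreover have "?c \<noteq> 0" using c by auto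
    ultimately have "{v. N (\<gamma> s) \<bullet> v = 0} = {v. N' (\<gamma> s) \<bullet> v = 0}"
      by simp
    moreover have "\<gamma> s \<in> M \<inter> M'" using s assms(7) by auto
    ultimately show False
      using tangent_space_eq_hyperplane reg assms(3,4,5)
      unfolding intersect_transversally_def by auto
  qed
  show ?thesis
  proof
    assume "pseudo_geodesic_line I \<gamma> M' N'"
    then obtain \<theta>' where \<theta>': "\<And>s. s \<in> I \<Longrightarrow> principal_normal \<gamma> s =
        sin \<theta>' *\<^sub>R (N' (\<gamma> s) \<times> unit_tangent \<gamma> s) + cos \<theta>' *\<^sub>R N' (\<gamma> s)"
      unfolding pseudo_geodesic_line_def by blast
    have const: "N (\<gamma> s) \<bullet> N' (\<gamma> s) = cos (\<theta> - \<theta>')" if "s \<in> I" for s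
      using normal_frame.angle_difference[OF frame[OF that]] \<theta>[OF that] \<theta>'[OF that] by simp
    obtain s\<^sub>0 where "s\<^sub>0 \<in> I" using \<open>I \<noteq> {}\<close> by blast
    then have "\<bar>cos (\<theta> - \<theta>')\<bar> < 1" using transversal const by metis
    \<comment> \<open>The difference of the two angles need not lie between 0 and pi, so the
      unoriented angle is the arccos of its cosine; transversality at one point excludes the
      endpoints.\<close>
    then have "0 < arccos (cos (\<theta> - \<theta>'))" "arccos (cos (\<theta> - \<theta>')) < pi"
      using arccos_lt_bounded by (auto simp: abs_less_iff)
    then show "intersect_with_constant_angle I \<gamma> N N'"
      unfolding intersect_with_constant_angle_def using vec_angle const by auto
  next
    assume "intersect_with_constant_angle I \<gamma> N N'"
    then obtain \<xi> where \<xi>: "0 < \<xi>" "\<xi> < pi"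
      and ang: "\<And>s. s \<in> I \<Longrightarrow> vec_angle (N (\<gamma> s)) (N' (\<gamma> s)) = \<xi>"
      unfolding intersect_with_constant_angle_def by blast
    have cos_\<xi>: "N (\<gamma> s) \<bullet> N' (\<gamma> s) = cos \<xi>" if "s \<in> I" for s
      using ang[OF that] vec_angle[OF that] bound[OF that] by (metis cos_arccos_abs)
    define g where "g s = N' (\<gamma> s) \<bullet> (N (\<gamma> s) \<times> unit_tangent \<gamma> s)" for s
    have "(g s)\<^sup>2 = (sin \<xi>)\<^sup>2" if "s \<in> I" for s
      using normal_frame.sum_squares[OF frame[OF that]] cos_\<xi>[OF that]
      unfolding g_def sin_squared_eq by simp
    then have g_values: "g s = sin \<xi> \<or> g s = - sin \<xi>" if "s \<in> I" for s
      using that power2_eq_iff by blast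
    have "continuous_on I \<gamma>" using I(4) by (rule smooth_on_imp_continuous_on)
    then have "continuous_on I (\<lambda>s. N (\<gamma> s))" "continuous_on I (\<lambda>s. N' (\<gamma> s))"
      using gauss_map_continuous_on reg assms(3,4) in_M continuous_on_compose2 by blast+
    then have "continuous_on I g"
      unfolding g_def
      by (intro continuous_on_inner continuous_on_cross unit_tangent_continuous_on I(4))
    text \<open>The sine of the oriented angle from \<open>N\<close> to \<open>N'\<close> cannot switch between
      \<open>sin \<xi>\<close> and \<open>- sin \<xi>\<close>, since \<open>I\<close> is connected.\<close>
    moreover have "connected I" using I(2) is_interval_connected by blast
    ultimately have "connected (g ` I)" by (rule connected_continuous_image)
    moreover have "finite (g ` I)"
      by (rule finite_subset[of _ "{sin \<xi>, - sin \<xi>}"]) (use g_values in auto)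
    ultimately obtain c where c: "\<And>s. s \<in> I \<Longrightarrow> g s = c"
      using connected_finite_iff_sing \<open>I \<noteq> {}\<close> by (metis image_eqI image_is_empty singletonD)
    obtain s\<^sub>0 where "s\<^sub>0 \<in> I" using \<open>I \<noteq> {}\<close> by blast
    then have "c = sin \<xi> \<or> c = sin (- \<xi>)" using g_values c by force
    \<comment> \<open>Either \<phi> = \<xi> or \<phi> = -\<xi>, according to the sign of the sine;
      the cosine is even and does not change.\<close>
    then obtain \<phi> where \<phi>: "cos \<phi> = cos \<xi>" "sin \<phi> = c" by (metis cos_minus)
    have "principal_normal \<gamma> s = sin (\<theta> - \<phi>) *\<^sub>R (N' (\<gamma> s) \<times> unit_tangent \<gamma> s)
        + cos (\<theta> - \<phi>) *\<^sub>R N' (\<gamma> s)" if "s \<in> I" for s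
      using normal_frame.rotate_normal[OF frame[OF that]] \<theta>[OF that] cos_\<xi>[OF that] c[OF that] \<phi>
      unfolding g_def by simp
    then show "pseudo_geodesic_line I \<gamma> M' N'"
      unfolding pseudo_geodesic_line_def using assms(6) in_M by blast
  qed
qed

end
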